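(* Let $(X,T)$ be a TDS and let $\mu$ be a $T$-invariant Borel probability measure on $X$. Then $$\overline{D}_\mu(X,T)\le \overline{D}(X,T).$$
   Context: A TDS (topological dynamical system) $(X,T)$ is a compact metrizable space $X$ with a surjective continuous map $T:X\to X$. $\mathbb{N}=\{1,2,\dots\}$. For an increasing sequence $S=\{s_1<s_2<\cdots\}\subset\mathbb{N}$ define the upper dimension $\overline{D}(S)=\inf\{\tau\ge0:\limsup_{n\to\infty} n/(s_n)^\tau=0\}$. Metric side. For a finite Borel partition $\alpha$ of $X$, $S$ is an entropy generating sequence of $\alpha$ if $\liminf_{n\to\infty}\frac1n H_\mu(\bigvee_{i=1}^n T^{-s_i}\alpha)>0$, with $H_\mu$ Shannon entropy. The upper entropy dimension $\overline{D}_\mu(T,\alpha)$ is the supremum of $\overline{D}(S)$ over all entropy generating sequences $S$ of $\alpha$ ($0$ if there are none), and $\overline{D}_\mu(X,T)=\sup_\alpha\overline{D}_\mu(T,\alpha)$ over all finite Borel partitions $\alpha$. Topological side. For a finite open cover $\mathcal{U}$ of $X$, $\mathcal{N}(\mathcal{U})$ is the minimal cardinality of a subcover of $\mathcal{U}$. $S$ is an entropy generating sequence of $\mathcal{U}$ if $\liminf_{n\to\infty}\frac1n\log\mathcal{N}(\bigvee_{i=1}^n T^{-s_i}\mathcal{U})>0$. $\overline{D}(T,\mathcal{U})$ is the supremum of $\overline{D}(S)$ over all entropy generating sequences $S$ of $\mathcal{U}$ ($0$ if there are none), and $\overline{D}(X,T)=\sup_{\mathcal{U}}\overline{D}(T,\mathcal{U})$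 over all finite open covers $\mathcal{U}$ of $X$. *)

theory Defs
  imports "HOL-Probability.Probability"
begin

definition tds :: "('a::topological_space \<Rightarrow> 'a) \<Rightarrow> bool" where
  "tds T \<longleftrightarrow> compact (UNIV :: 'a set) \<and> metrizable_space (euclidean :: 'a topology) \<and>
     continuous_on UNIV T \<and> surj T"

definition invariant_prob :: "('a::topological_space \<Rightarrow> 'a) \<Rightarrow> 'a measure \<Rightarrow> bool" where
  "invariant_prob T \<mu> \<longleftrightarrow> prob_space \<mu> \<and> sets \<mu> = sets borel \<and>
     (\<forall>A\<in>sets borel. emeasure \<mu> (T -` A) = emeasure \<mu> A)"

(* An infinite set S = {s_1 < s_2 < ...} of positive integers is given by its enumeration s,
   indexed from 1; the value s 0 is irrelevant. *)
definition increasing_seq :: "(nat \<Rightarrow> nat) \<Rightarrow> bool" where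
  "increasing_seq s \<longleftrightarrow> strict_mono_on {1..} s \<and> (\<forall>n\<ge>1. s n \<ge> 1)"

definition upper_dim :: "(nat \<Rightarrow> nat) \<Rightarrow> ennreal" where
  "upper_dim s =
     (INF \<tau>\<in>{\<tau>::real. \<tau> \<ge> 0 \<and> limsup (\<lambda>n. ereal (real n / real (s n) powr \<tau>)) = 0}. ennreal \<tau>)"

definition family_join :: "'i set \<Rightarrow> ('i \<Rightarrow> 'a set set) \<Rightarrow> 'a set set" where
  "family_join I \<U> = {(\<Inter>i\<in>I. f i) | f. \<forall>i\<in>I. f i \<in> \<U> i}"

(* The join of T^{-s_1} \<U>, ..., T^{-s_n} \<U>. *)
definition seq_join :: "('a \<Rightarrow> 'a) \<Rightarrow> (nat \<Rightarrow> nat) \<Rightarrow> nat \<Rightarrow> 'a set set \<Rightarrow> 'a set set" where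
  "seq_join T s n \<U> = family_join {1..n} (\<lambda>i. (\<lambda>A. (T ^^ s i) -` A) ` \<U>)"

definition finite_borel_partition :: "'a::topological_space set set \<Rightarrow> bool" where
  "finite_borel_partition \<alpha> \<longleftrightarrow> finite \<alpha> \<and> \<alpha> \<subseteq> sets borel \<and> partition_on UNIV \<alpha>"

(* Since ln 0 = 0, null cells contribute 0. *)
definition shannon_entropy :: "'a measure \<Rightarrow> 'a set set \<Rightarrow> real" where
  "shannon_entropy \<mu> \<alpha> = - (\<Sum>A\<in>\<alpha>. measure \<mu> A * ln (measure \<mu> A))"

definition measure_entropy_generating ::
    "'a measure \<Rightarrow> ('a \<Rightarrow> 'a) \<Rightarrow> 'a set set \<Rightarrow> (nat \<Rightarrow> nat) \<Rightarrow> bool" where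
  "measure_entropy_generating \<mu> T \<alpha> s \<longleftrightarrow> increasing_seq s \<and>
     liminf (\<lambda>n. ereal (1 / real n * shannon_entropy \<mu> (seq_join T s n \<alpha>))) > 0"

(* In ennreal the supremum of the empty set is 0, as required when there are no
   entropy generating sequences; the same applies to cover_upper_dim below. *)
definition partition_upper_dim :: "'a measure \<Rightarrow> ('a \<Rightarrow> 'a) \<Rightarrow> 'a set set \<Rightarrow> ennreal" where
  "partition_upper_dim \<mu> T \<alpha> = (SUP s\<in>{s. measure_entropy_generating \<mu> T \<alpha> s}. upper_dim s)"

definition measure_upper_entropy_dim ::
    "'a::topological_space measure \<Rightarrow> ('a \<Rightarrow> 'a) \<Rightarrow> ennreal" where
  "measure_upper_entropy_dim \<mu> T =
     (SUP \<alpha>\<in>{\<alpha>. finite_borel_partition \<alpha>}. partition_upper_dim \<mu> T \<alpha>)"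

definition finite_open_cover :: "'a::topological_space set set \<Rightarrow> bool" where
  "finite_open_cover \<U> \<longleftrightarrow> finite \<U> \<and> (\<forall>U\<in>\<U>. open U) \<and> \<Union>\<U> = UNIV"

definition min_subcover_card :: "'a set set \<Rightarrow> nat" where
  "min_subcover_card \<U> = Inf {card \<V> | \<V>. \<V> \<subseteq> \<U> \<and> finite \<V> \<and> \<Union>\<V> = UNIV}"

definition cover_entropy_generating ::
    "('a \<Rightarrow> 'a) \<Rightarrow> 'a set set \<Rightarrow> (nat \<Rightarrow> nat) \<Rightarrow> bool" where
  "cover_entropy_generating T \<U> s \<longleftrightarrow> increasing_seq s \<and>
     liminf (\<lambda>n. ereal (1 / real n * ln (real (min_subcover_card (seq_join T s n \<U>))))) > 0"

definition cover_upper_dim :: "('a \<Rightarrow> 'a) \<Rightarrow> 'a set set \<Rightarrow> ennreal" where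
  "cover_upper_dim T \<U> = (SUP s\<in>{s. cover_entropy_generating T \<U> s}. upper_dim s)"

definition top_upper_entropy_dim :: "('a::topological_space \<Rightarrow> 'a) \<Rightarrow> ennreal" where
  "top_upper_entropy_dim T = (SUP \<U>\<in>{\<U>. finite_open_cover \<U>}. cover_upper_dim T \<U>)"

end

theory Submission
  imports Defs
begin

text \<open>
  Every sequence \<open>s\<close> that generates entropy for a finite Borel partition \<open>\<alpha>\<close> also
  generates entropy for a suitable finite open cover, so the supremum on the topological side runs
  over at least the upper dimensions that occur on the measure side. The cover depends on \<open>\<alpha>\<close>
  and \<open>s\<close>, but the sequence itself need not be thinned out or changed.

  By regularity of \<open>\<mu>\<close> (\<open>closed_open_sandwich\<close>), each cell \<open>A\<close> contains a closed core \<open>B A\<close>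
  with \<open>A - B A\<close> of tiny measure. For each cell \<open>A\<close>, the union of \<open>B A\<close> and the small residual set
  outside all the cores is open, because its complement is the union of the finitely many other
  cores. These open sets form a cover, and a point of a core lies in exactly one core, whose cell is
  therefore known once it is known which member of the cover contains the point.

  The usual comparison between a partition and such a cover counts that a member of the
  \<open>n\<close>-fold join of the cover meets at most \<open>2^n\<close> cells of the join of
  the partition, and so loses \<open>n ln 2\<close>. That loss is normally removed by passing to a power of
  \<open>T\<close>, which is no option for a fixed sequence of times. Instead, the loss is measured by
  entropy. Let \<open>e x\<close> be a blank if \<open>x\<close> lies in a core, and otherwise the cell of \<open>x\<close>.
  Pick a minimal subcover of the join of the cover. The itinerary of \<open>x\<close> in \<open>\<alpha>\<close> along the times
  \<open>s 1, \<dots>, s n\<close> is determined by the index of the first member of the subcover that contains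
  \<open>x\<close>, together with the values of \<open>e\<close> along these times: at a blank the member of the subcover
  names the cell, elsewhere \<open>e\<close> does. Since an index has entropy at most the logarithm of the
  number of its values, monotonicity and subadditivity of entropy give
  \<open>H(\<Squnion>\<alpha>) \<le> ln N + n H(e)\<close> (\<open>shannon_entropy_seq_join_le\<close>), with invariance of \<open>\<mu>\<close>
  making all \<open>n\<close> observations of \<open>e\<close> equally distributed. As \<open>e\<close> is almost constant, \<open>H(e)\<close>
  is as small as desired (\<open>entropy_le_almost_constant\<close>), in particular at most half of the growth
  rate of \<open>H(\<Squnion>\<alpha>)\<close>. The other half must then come from \<open>ln N\<close>.
\<close>

section \<open>Regularity of finite Borel measures on metrizable spaces\<close>

text \<open>
  The sets that can be approximated from inside by closed and from outside by open sets form a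
  sigma-algebra, and open sets are among them because in a metrizable space they are increasing
  unions of closed sets. Asking for both approximations at once is what makes the property stable
  under complements. The hypothesis is metrizability of the topology since the type carries no
  metric.
\<close>

lemma closed_open_sandwich:
  fixes M :: "'a::topological_space measure"
  assumes "finite_measure M" and sets_M: "sets M = sets borel"
    and metr: "metrizable_space (euclidean :: 'a topology)"
    and A: "A \<in> sets borel" and "\<epsilon> > 0"
  shows "\<exists>C U. closed C \<and> open U \<and> C \<subseteq> A \<and> A \<subseteq> U \<and> measure M (U - C) < \<epsilon>"
proof -
  interpret finite_measure M by fact
  have meas: "U - C \<in> sets M" if "open U" "closed C" for U C
    using that by (simp add: sets_M)
  have "A \<in> sigma_sets UNIV {S. open S}"
    using A by (simp add: sets_borel)
  then show ?thesis
    using \<open>\<epsilon> > 0\<close>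
  proof (induction A arbitrary: \<epsilon> rule: sigma_sets.induct)
    case (Basic U)
    then have "open U" by simp
    then have "fsigma_in euclidean U"
      using open_imp_fsigma_in[OF metr] by simp
    then obtain C where C: "\<And>n. closed (C n)" "\<And>n. C n \<subseteq> C (Suc n)" "\<Union>(range C) = U"
      unfolding fsigma_in_ascending by auto
    have "(\<lambda>n. measure M (U - C n)) \<longlonglongrightarrow> measure M (\<Inter>n. U - C n)"
      using C meas \<open>open U\<close> by (intro finite_Lim_measure_decseq) (auto simp: decseq_Suc_iff)
    moreover have "(\<Inter>n. U - C n) = {}"
      using C(3) by auto
    ultimately have "(\<lambda>n. measure M (U - C n)) \<longlonglongrightarrow> 0"
      by (simp only: measure_empty)
    then have "\<forall>\<^sub>F n in sequentially. measure M (U - C n) < \<epsilon>"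
      using Basic.prems by (rule order_tendstoD)
    then obtain n where "measure M (U - C n) < \<epsilon>"
      by (auto simp: eventually_sequentially)
    then show ?case
      using C \<open>open U\<close> by (intro exI[of _ "C n"] exI[of _ U] conjI) auto
  next
    case Empty
    then show ?case
      by (intro exI[of _ "{}"] conjI) simp_all
  next
    case (Compl A)
    from Compl.IH[OF Compl.prems]
    obtain C U where "closed C" "open U" "C \<subseteq> A" "A \<subseteq> U" "measure M (U - C) < \<epsilon>"
      by (elim exE conjE)
    moreover have "- C - - U = U - C"
      by auto
    ultimately show ?case
      by (intro exI[of _ "- U"] exI[of _ "- C"] conjI)
        (simp_all add: open_Compl closed_Compl Compl_eq_Diff_UNIV[symmetric])
  next
    case (Union A)
    have "\<exists>C U. closed C \<and> open U \<and> C \<subseteq> A i \<and> A i \<subseteq> U \<and> measure M (U - C) < \<epsilon> * (1/2) ^ (i + 2)" for i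
      using Union.IH[of "\<epsilon> * (1/2) ^ (i + 2)" i] Union.prems by simp
    then obtain C U where CU: "\<And>i. closed (C i)" "\<And>i. open (U i)" "\<And>i. C i \<subseteq> A i" "\<And>i. A i \<subseteq> U i"
        "\<And>i. measure M (U i - C i) < \<epsilon> * (1/2) ^ (i + 2)"
      by metis
    have sums: "(\<lambda>i. \<epsilon> * (1/2) ^ (i + 2)) sums (\<epsilon> / 2)"
      using sums_mult[OF geometric_sums[of "1/2::real"], of "\<epsilon> / 4"] by (simp add: power_add)
    have "norm (measure M (U i - C i)) \<le> \<epsilon> * (1/2) ^ (i + 2)" for i
      using CU(5)[of i] by (simp only: real_norm_def abs_of_nonneg[OF measure_nonneg] less_imp_le)
    then have summable: "summable (\<lambda>i. measure M (U i - C i))"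
      by (rule summable_comparison_test'[OF sums_summable[OF sums], of 0])
    \<comment> \<open>A countable union of closed sets need not be closed: truncate it.
      The sets \<open>D n\<close> decrease to a set of measure at most \<open>\<epsilon> / 2\<close>.\<close>
    define D where "D n = (\<Union>i. U i) - (\<Union>i<n. C i)" for n
    have D_sets: "D n \<in> sets M" for n
      unfolding D_def using CU by (intro meas) auto
    have "(\<lambda>n. measure M (D n)) \<longlonglongrightarrow> measure M (\<Inter>n. D n)"
      using D_sets by (intro finite_Lim_measure_decseq)
        (auto simp: decseq_def D_def intro: order_less_le_trans)
    moreover have "measure M (\<Inter>n. D n) < \<epsilon>"
    proof -
      have "measure M (\<Inter>n. D n) \<le> measure M (\<Union>i. U i - C i)"
      proof (rule finite_measure_mono)
        show "(\<Inter>n. D n) \<subseteq> (\<Union>i. U i - C i)"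
        proof
          fix x assume x: "x \<in> (\<Inter>n. D n)"
          then have "x \<in> D 0"
            by blast
          then obtain i where "x \<in> U i"
            by (auto simp: D_def)
          moreover have "x \<in> D (Suc i)"
            using x by blast
          then have "x \<notin> C i"
            by (auto simp: D_def)
          ultimately show "x \<in> (\<Union>i. U i - C i)"
            by blast
        qed
        show "(\<Union>i. U i - C i) \<in> sets M"
          using CU(1,2) meas by (intro sets.countable_UN) auto
      qed
      also have "\<dots> \<le> (\<Sum>i. measure M (U i - C i))"
        using CU meas summable by (intro finite_measure_subadditive_countably) auto
      also have "\<dots> \<le> (\<Sum>i. \<epsilon> * (1/2) ^ (i + 2))"
        using summable sums_summable[OF sums] by (rule suminf_le[OF less_imp_le[OF CU(5)]])
      also have "\<dots> = \<epsilon> / 2"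
        using sums by (rule sums_unique[symmetric])
      also have "\<dots> < \<epsilon>"
        using Union.prems by simp
      finally show ?thesis .
    qed
    ultimately have "\<forall>\<^sub>F n in sequentially. measure M (D n) < \<epsilon>"
      by (rule order_tendstoD)
    then obtain n where "measure M (D n) < \<epsilon>"
      by (auto simp: eventually_sequentially)
    moreover have "(\<Union>i<n. C i) \<subseteq> (\<Union>i. A i)"
      by (intro UN_mono subset_UNIV CU(3))
    moreover have "(\<Union>i. A i) \<subseteq> (\<Union>i. U i)"
      by (intro UN_mono order_refl CU(4))
    moreover have "closed (\<Union>i<n. C i)" "open (\<Union>i. U i)"
      by (intro closed_UN open_UN finite_lessThan ballI CU(1,2))+
    ultimately show ?case
      unfolding D_def
      by (intro exI[of _ "\<Union>i<n. C i"] exI[of _ "\<Union>i. U i"] conjI)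
  qed
qed

section \<open>Entropy of finitely valued functions\<close>

text \<open>
  A power of \<open>t\<close> with exponent below 1 is enough to see that a value of small probability
  contributes little entropy. The bound is \<open>ln y \<le> y - 1\<close> for \<open>y\<close> the
  reciprocal of the square root of \<open>t\<close>.
\<close>

lemma neg_mult_ln_le_sqrt:
  fixes t :: real
  assumes "0 \<le> t"
  shows "- (t * ln t) \<le> 2 * sqrt t - 2 * t"
proof (cases "t = 0")
  case False
  with assms have t: "t > 0" by simp
  define q where "q = sqrt t"
  have q: "q > 0" "t = q * q"
    using t by (auto simp: q_def)
  have "- ln q \<le> 1 / q - 1"
    using ln_le_minus_one[of "1 / q"] q by (simp add: ln_div)
  then have "2 * (q * q) * (- ln q) \<le> 2 * (q * q) * (1 / q - 1)"
    using q by (intro mult_left_mono) auto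
  also have "\<dots> = 2 * q - 2 * (q * q)"
    using q by (simp add: field_simps)
  finally show ?thesis
    using q by (simp add: ln_mult q_def[symmetric])
qed simp

lemma neg_mult_ln_le_compl:
  fixes t :: real
  assumes "0 \<le> t"
  shows "- (t * ln t) \<le> 1 - t"
proof (cases "t = 0")
  case False
  with assms have t: "t > 0" by simp
  have "t * (- ln t) \<le> t * (1 / t - 1)"
    using ln_le_minus_one[of "1 / t"] t by (intro mult_left_mono) (auto simp: ln_div)
  also have "\<dots> = 1 - t"
    using t by (simp add: field_simps)
  finally show ?thesis by simp
qed simp

context information_space
begin

lemma entropy_eq_sum:
  assumes "simple_function M X"
  shows "\<H>(X) = - (\<Sum>v\<in>X ` space M. prob (X -` {v} \<inter> space M) * log b (prob (X -` {v} \<inter> space M)))"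
  using entropy_simple_distributed[OF simple_distributedI[OF assms measure_nonneg refl]] .

lemma entropy_Pair_le:
  assumes "simple_function M X" "simple_function M Y"
  shows "\<H>(\<lambda>x. (X x, Y x)) \<le> \<H>(X) + \<H>(Y)"
  using entropy_chain_rule[OF assms] conditional_entropy_less_eq_entropy[OF assms(2,1)] by simp

lemma simple_function_restrict:
  assumes "finite I" "\<And>i. i \<in> I \<Longrightarrow> simple_function M (Y i)"
  shows "simple_function M (\<lambda>x. \<lambda>i\<in>I. Y i x)"
  using assms
proof (induction I)
  case empty
  then show ?case by (simp add: restrict_def)
next
  case (insert i I)
  have "simple_function M (\<lambda>x. (\<lambda>j\<in>I. Y j x)(i := Y i x))"
    using insert.prems insert.IH
    by (intro simple_function_compose2[where h="\<lambda>f y. f(i := y)"]) blast+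
  moreover have "(\<lambda>x. \<lambda>j\<in>insert i I. Y j x) = (\<lambda>x. (\<lambda>j\<in>I. Y j x)(i := Y i x))"
    by (auto simp: fun_eq_iff)
  ultimately show ?case
    by (simp only:)
qed

text \<open>
  Subadditivity for finitely many functions observed jointly. The restriction to \<open>I\<close> keeps the joint
  observation finitely valued.
\<close>

lemma entropy_restrict_le:
  assumes "finite I" "\<And>i. i \<in> I \<Longrightarrow> simple_function M (Y i)"
  shows "\<H>(\<lambda>x. \<lambda>i\<in>I. Y i x) \<le> (\<Sum>i\<in>I. \<H>(Y i))"
  using assms
proof (induction I)
  case empty
  have "\<H>(\<lambda>x. \<lambda>i\<in>{}. Y i x) \<le> log b (real (card ((\<lambda>x. \<lambda>i\<in>{}. Y i x) ` space M)))"
    by (rule entropy_le_card[OF simple_distributedI[OF _ measure_nonneg refl]])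
      (simp add: restrict_def)
  also have "\<dots> = 0"
    using not_empty by (simp add: restrict_def image_constant_conv)
  finally show ?case by (simp only: sum.empty)
next
  case (insert i I)
  let ?Z = "\<lambda>x. \<lambda>j\<in>I. Y j x"
  have Y: "simple_function M (Y i)" and Z: "simple_function M ?Z"
    using insert by (auto intro!: simple_function_restrict)
  have "(\<lambda>x. \<lambda>j\<in>insert i I. Y j x) = (\<lambda>(y, f). f(i := y)) \<circ> (\<lambda>x. (Y i x, ?Z x))"
    by (auto simp: fun_eq_iff)
  then have "\<H>(\<lambda>x. \<lambda>j\<in>insert i I. Y j x) = \<H>((\<lambda>(y, f). f(i := y)) \<circ> (\<lambda>x. (Y i x, ?Z x)))"
    by (rule arg_cong)
  also have "\<dots> \<le> \<H>(\<lambda>x. (Y i x, ?Z x))"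
    by (rule entropy_data_processing[OF simple_function_Pair[OF Y Z]])
  also have "\<dots> \<le> \<H>(Y i) + \<H>(?Z)"
    using Y Z by (rule entropy_Pair_le)
  also have "\<dots> \<le> \<H>(Y i) + (\<Sum>j\<in>I. \<H>(Y j))"
    using insert.prems by (intro add_left_mono insert.IH) blast
  also have "\<dots> = (\<Sum>j\<in>insert i I. \<H>(Y j))"
    using insert.hyps by simp
  finally show ?case .
qed

text \<open>
  The dominant value \<open>v0\<close> contributes at most the probability of its complement, and each of the
  exceptional values contributes at most about twice the square root of its probability. Bounding the
  probabilities by a square keeps the result linear in \<open>r\<close>.
\<close>

lemma entropy_le_almost_constant:
  assumes b: "b = exp 1"
    and X: "simple_function M X"
    and range: "X ` space M \<subseteq> insert v0 V" and "finite V" "v0 \<notin> V"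
    and small: "\<And>v. v \<in> V \<Longrightarrow> prob (X -` {v} \<inter> space M) \<le> r\<^sup>2" and "0 \<le> r"
  shows "\<H>(X) \<le> 2 * real (card V) * r"
proof -
  define p where "p v = prob (X -` {v} \<inter> space M)" for v
  have "\<H>(X) = - (\<Sum>v\<in>X ` space M. p v * ln (p v))"
    unfolding p_def using entropy_eq_sum[OF X] by (simp add: log_def b)
  also have "(\<Sum>v\<in>X ` space M. p v * ln (p v)) = (\<Sum>v\<in>insert v0 V. p v * ln (p v))"
  proof (intro sum.mono_neutral_left ballI range)
    fix v assume "v \<in> insert v0 V - X ` space M"
    then have "X -` {v} \<inter> space M = {}" by auto
    then show "p v * ln (p v) = 0" by (simp add: p_def)
  qed (use \<open>finite V\<close> in simp)
  also have "- \<dots> = - (p v0 * ln (p v0)) + (\<Sum>v\<in>V. - (p v * ln (p v)))"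
    using \<open>finite V\<close> \<open>v0 \<notin> V\<close> by (simp add: sum_negf)
  also have "- (p v0 * ln (p v0)) \<le> 1 - p v0"
    by (rule neg_mult_ln_le_compl) (simp add: p_def)
  also have "1 - p v0 = (\<Sum>v\<in>V. p v)"
  proof -
    have sets: "X -` {v} \<inter> space M \<in> sets M" for v
      using simple_functionD(2)[OF X] .
    have "prob (\<Union>v\<in>insert v0 V. X -` {v} \<inter> space M) = (\<Sum>v\<in>insert v0 V. p v)"
      unfolding p_def using \<open>finite V\<close> sets
      by (intro finite_measure_finite_Union) (auto simp: disjoint_family_on_def)
    moreover have "(\<Union>v\<in>insert v0 V. X -` {v} \<inter> space M) = space M"
      using range by auto
    ultimately show ?thesis
      using \<open>finite V\<close> \<open>v0 \<notin> V\<close> prob_space by simp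
  qed
  also have "(\<Sum>v\<in>V. p v) + (\<Sum>v\<in>V. - (p v * ln (p v))) = (\<Sum>v\<in>V. p v - p v * ln (p v))"
    by (simp add: sum.distrib[symmetric])
  also have "\<dots> \<le> (\<Sum>v\<in>V. 2 * r)"
  proof (rule sum_mono)
    fix v assume "v \<in> V"
    have "p v \<ge> 0" by (simp add: p_def)
    moreover have "sqrt (p v) \<le> r"
      using small[OF \<open>v \<in> V\<close>] \<open>0 \<le> r\<close> by (intro real_le_lsqrt) (auto simp: p_def)
    ultimately show "p v - p v * ln (p v) \<le> 2 * r"
      using neg_mult_ln_le_sqrt[of "p v"] by linarith
  qed
  also have "\<dots> = 2 * real (card V) * r"
    by simp
  finally show ?thesis by simp
qed

text \<open>
  Translates a family of sets into the function whose level sets are its nonempty members. The empty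
  set has to be removed because a join of partitions contains it whenever some choice of cells has
  empty intersection. It has measure zero and contributes nothing.
\<close>

lemma shannon_entropy_eq_entropy:
  assumes b: "b = exp 1" and X: "simple_function M X"
    and cells: "P - {{}} = (\<lambda>x. X -` {X x} \<inter> space M) ` space M"
  shows "shannon_entropy M P = \<H>(X)"
proof -
  let ?cell = "\<lambda>v. X -` {v} \<inter> space M"
  have P: "P - {{}} = ?cell ` X ` space M"
    unfolding cells by auto
  have "finite (P - {{}})"
    unfolding P using simple_functionD(1)[OF X] by blast
  then have "(\<Sum>A\<in>P. prob A * ln (prob A)) = (\<Sum>A\<in>P - {{}}. prob A * ln (prob A))"
    by (intro sum.mono_neutral_right) auto
  also have "\<dots> = (\<Sum>v\<in>X ` space M. prob (?cell v) * ln (prob (?cell v)))"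
    unfolding P by (subst sum.reindex) (auto simp: inj_on_def)
  finally show ?thesis
    unfolding shannon_entropy_def using entropy_eq_sum[OF X] by (simp add: log_def b)
qed

end

section \<open>Joins along a sequence and minimal subcovers\<close>

lemma min_subcover_list:
  assumes "finite \<U>" "\<Union>\<U> = UNIV"
  obtains vs where "set vs \<subseteq> \<U>" "\<Union>(set vs) = UNIV" "length vs = min_subcover_card \<U>"
proof -
  let ?N = "{card \<V> | \<V>. \<V> \<subseteq> \<U> \<and> finite \<V> \<and> \<Union>\<V> = UNIV}"
  have "min_subcover_card \<U> \<in> ?N"
    unfolding min_subcover_card_def using assms by (intro Inf_nat_def1) auto
  then obtain \<V> where \<V>: "\<V> \<subseteq> \<U>" "finite \<V>" "\<Union>\<V> = UNIV" "min_subcover_card \<U> = card \<V>"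
    by auto
  moreover obtain vs where "set vs = \<V>" "distinct vs"
    using finite_distinct_list[OF \<open>finite \<V>\<close>] by blast
  ultimately show ?thesis
    using that[of vs] distinct_card by metis
qed

text \<open>
  Selecting the first member of the list that contains a point turns a cover by measurable sets into a
  measurable function with at most as many values as the list has entries.
\<close>

lemma simple_function_first_index:
  assumes sets: "\<And>V. V \<in> set vs \<Longrightarrow> V \<in> sets M" and cover: "space M \<subseteq> \<Union>(set vs)"
  obtains K :: "'a \<Rightarrow> nat"
  where "simple_function M K" "\<And>x. x \<in> space M \<Longrightarrow> K x < length vs \<and> x \<in> vs ! K x"
proof -
  define K where "K x = (LEAST j. j < length vs \<and> x \<in> vs ! j)" for x
  have K: "K x < length vs \<and> x \<in> vs ! K x" if "x \<in> space M" for x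
    unfolding K_def
  proof (rule LeastI_ex)
    show "\<exists>j. j < length vs \<and> x \<in> vs ! j"
      using that cover by (metis UnionE in_set_conv_nth subsetD)
  qed
  have "Measurable.pred M (\<lambda>x. j < length vs \<and> x \<in> vs ! j)" for j
    using sets by (cases "j < length vs") auto
  then have "K \<in> measurable M (count_space UNIV)"
    unfolding K_def[abs_def] by (rule measurable_Least)
  moreover have "finite (K ` space M)"
    by (rule finite_subset[of _ "{..<length vs}"]) (use K in auto)
  ultimately have "simple_function M K"
    by (simp add: simple_function_eq_measurable)
  then show ?thesis
    using K by (rule that)
qed

lemma mem_seq_join:
  "C \<in> seq_join T s n \<U> \<longleftrightarrow> (\<exists>a. (\<forall>i\<in>{1..n}. a i \<in> \<U>) \<and> C = (\<Inter>i\<in>{1..n}. (T ^^ s i) -` a i))"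
proof
  assume "C \<in> seq_join T s n \<U>"
  then obtain f where f: "C = (\<Inter>i\<in>{1..n}. f i)" "\<forall>i\<in>{1..n}. f i \<in> (\<lambda>A. (T ^^ s i) -` A) ` \<U>"
    unfolding seq_join_def family_join_def by (elim CollectE exE conjE)
  from f(2) have "\<forall>i\<in>{1..n}. \<exists>A. A \<in> \<U> \<and> f i = (T ^^ s i) -` A"
    by (simp only: image_iff Bex_def)
  from bchoice[OF this] obtain a where "\<forall>i\<in>{1..n}. a i \<in> \<U> \<and> f i = (T ^^ s i) -` a i" ..
  with f(1) show "\<exists>a. (\<forall>i\<in>{1..n}. a i \<in> \<U>) \<and> C = (\<Inter>i\<in>{1..n}. (T ^^ s i) -` a i)"
    by (intro exI[of _ a]) simp
next
  assume "\<exists>a. (\<forall>i\<in>{1..n}. a i \<in> \<U>) \<and> C = (\<Inter>i\<in>{1..n}. (T ^^ s i) -` a i)"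
  then obtain a where "\<forall>i\<in>{1..n}. a i \<in> \<U>" "C = (\<Inter>i\<in>{1..n}. (T ^^ s i) -` a i)"
    by blast
  then have "C = (\<Inter>i\<in>{1..n}. (T ^^ s i) -` a i)"
      "\<forall>i\<in>{1..n}. (T ^^ s i) -` a i \<in> (\<lambda>A. (T ^^ s i) -` A) ` \<U>"
    by blast+
  then show "C \<in> seq_join T s n \<U>"
    unfolding seq_join_def family_join_def by (intro CollectI exI[of _ "\<lambda>i. (T ^^ s i) -` a i"] conjI)
qed

lemma finite_seq_join:
  assumes "finite \<U>"
  shows "finite (seq_join T s n \<U>)"
proof -
  have "seq_join T s n \<U> \<subseteq> (\<lambda>a. \<Inter>i\<in>{1..n}. (T ^^ s i) -` a i) ` ({1..n} \<rightarrow>\<^sub>E \<U>)"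
  proof
    fix C assume "C \<in> seq_join T s n \<U>"
    then obtain a where a: "\<forall>i\<in>{1..n}. a i \<in> \<U>" "C = (\<Inter>i\<in>{1..n}. (T ^^ s i) -` a i)"
      unfolding mem_seq_join by blast
    then show "C \<in> (\<lambda>a. \<Inter>i\<in>{1..n}. (T ^^ s i) -` a i) ` ({1..n} \<rightarrow>\<^sub>E \<U>)"
      by (intro image_eqI[of _ _ "restrict a {1..n}"]) auto
  qed
  then show ?thesis
    by (rule finite_subset) (simp add: assms finite_PiE)
qed

lemma Union_seq_join:
  assumes "\<Union>\<U> = UNIV"
  shows "\<Union>(seq_join T s n \<U>) = UNIV"
proof -
  have "x \<in> \<Union>(seq_join T s n \<U>)" for x
  proof -
    have "\<exists>U\<in>\<U>. (T ^^ s i) x \<in> U" for i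
      using assms by blast
    then obtain a where a: "\<And>i. a i \<in> \<U> \<and> (T ^^ s i) x \<in> a i"
      by metis
    have "(\<Inter>i\<in>{1..n}. (T ^^ s i) -` a i) \<in> seq_join T s n \<U>"
      unfolding mem_seq_join by (intro exI[of _ a]) (simp add: a)
    moreover have "x \<in> (\<Inter>i\<in>{1..n}. (T ^^ s i) -` a i)"
      by (simp add: a)
    ultimately show ?thesis by (rule UnionI)
  qed
  then show ?thesis by blast
qed

section \<open>Comparison of partition entropy with an open cover\<close>

lemma continuous_on_funpow:
  fixes T :: "'a::topological_space \<Rightarrow> 'a"
  assumes "continuous_on UNIV T"
  shows "continuous_on UNIV (T ^^ m)"
proof (induction m)
  case (Suc m)
  then have "continuous_on UNIV (T \<circ> (T ^^ m))"
    by (rule continuous_on_compose) (rule continuous_on_subset[OF assms subset_UNIV])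
  then show ?case by simp
qed (simp add: id_def)

lemma invariant_prob_funpow:
  fixes T :: "'a::topological_space \<Rightarrow> 'a"
  assumes cont: "continuous_on UNIV T" and inv: "invariant_prob T \<mu>" and A: "A \<in> sets borel"
  shows "measure \<mu> ((T ^^ m) -` A) = measure \<mu> A"
proof (induction m)
  case (Suc m)
  have "(T ^^ m) -` A \<in> sets borel"
    using measurable_sets_borel[OF borel_measurable_continuous_onI[OF continuous_on_funpow[OF cont]] A] .
  then have "emeasure \<mu> (T -` ((T ^^ m) -` A)) = emeasure \<mu> ((T ^^ m) -` A)"
    using inv unfolding invariant_prob_def by blast
  moreover have "(T ^^ Suc m) -` A = T -` ((T ^^ m) -` A)"
    by (simp only: funpow_Suc_right vimage_comp)
  ultimately show ?case
    using Suc by (simp only: measure_def)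
qed simp

text \<open>
  When \<open>\<alpha>\<close> is a partition and each \<open>B A\<close> is a core contained in the cell \<open>A\<close>, the member of the
  cover that belongs to \<open>A\<close> is \<open>B A\<close> together with all points outside the cores. Writing it as the
  complement of the other cores makes it visibly open for closed cores.
\<close>

definition fattened_cover :: "'a set set \<Rightarrow> ('a set \<Rightarrow> 'a set) \<Rightarrow> 'a set set" where
  "fattened_cover \<alpha> B = (\<lambda>A. - (\<Union>A'\<in>\<alpha> - {A}. B A')) ` \<alpha>"

text \<open>
  These sets cover the space because a point of the cell \<open>A\<close> avoids the cores of all other cells.
\<close>

lemma finite_open_cover_fattened:
  fixes \<alpha> :: "'a::topological_space set set"
  assumes \<alpha>: "finite \<alpha>" "partition_on UNIV \<alpha>" and B: "\<And>A. A \<in> \<alpha> \<Longrightarrow> closed (B A)" "\<And>A. A \<in> \<alpha> \<Longrightarrow> B A \<subseteq> A"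
  shows "finite_open_cover (fattened_cover \<alpha> B)"
proof -
  have "x \<in> \<Union>(fattened_cover \<alpha> B)" for x
  proof -
    obtain A where A: "A \<in> \<alpha>" "x \<in> A"
      using partition_onD1[OF \<alpha>(2)] by blast
    have "x \<notin> B A'" if "A' \<in> \<alpha> - {A}" for A'
      using that A B(2)[of A'] partition_onD2[OF \<alpha>(2)] by (auto simp: disjoint_def)
    then show ?thesis
      using A unfolding fattened_cover_def by blast
  qed
  moreover have "open U" if "U \<in> fattened_cover \<alpha> B" for U
    using that \<alpha>(1) B(1) unfolding fattened_cover_def by (auto intro!: open_Compl closed_UN)
  ultimately show ?thesis
    using \<alpha>(1) unfolding finite_open_cover_def by (auto simp: fattened_cover_def)
qed

text \<open>
  The quantitative heart of the argument: replacing the partition by the cover costs at most a fixed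
  small amount of entropy per observation, namely a bound for the entropy of the function \<open>e\<close> that
  shows the cell of a point outside the cores and is blank on the cores.
\<close>

lemma shannon_entropy_seq_join_le:
  fixes T :: "'a::topological_space \<Rightarrow> 'a"
  assumes cont: "continuous_on UNIV T" and inv: "invariant_prob T \<mu>"
    and \<alpha>: "finite_borel_partition \<alpha>"
    and B: "\<And>A. A \<in> \<alpha> \<Longrightarrow> closed (B A)" "\<And>A. A \<in> \<alpha> \<Longrightarrow> B A \<subseteq> A"
    and small: "\<And>A. A \<in> \<alpha> \<Longrightarrow> measure \<mu> (A - B A) \<le> r\<^sup>2" and "0 \<le> r"
  shows "shannon_entropy \<mu> (seq_join T s n \<alpha>) \<le>
    ln (real (min_subcover_card (seq_join T s n (fattened_cover \<alpha> B)))) + real n * (2 * real (card \<alpha>) * r)"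
proof -
  have "prob_space \<mu>" and sets_\<mu>: "sets \<mu> = sets borel"
    using inv by (auto simp: invariant_prob_def)
  then interpret information_space \<mu> "exp 1"
    by (simp add: information_space_def information_space_axioms_def)
  have space: "space \<mu> = UNIV"
    using sets_eq_imp_space_eq[OF sets_\<mu>] by simp
  have "finite \<alpha>" and \<alpha>_sets: "\<And>A. A \<in> \<alpha> \<Longrightarrow> A \<in> sets borel" and part: "partition_on UNIV \<alpha>"
    using \<alpha> by (auto simp: finite_borel_partition_def)
  have Tm: "T ^^ m \<in> borel_measurable borel" for m
    using cont by (intro borel_measurable_continuous_onI continuous_on_funpow)
  then have Tm': "T ^^ m \<in> measurable \<mu> \<mu>" for m
    using measurable_cong_sets[OF sets_\<mu> sets_\<mu>] by blast

  define c where "c x = (THE A. A \<in> \<alpha> \<and> x \<in> A)" for x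
  have ex1: "\<exists>!A. A \<in> \<alpha> \<and> x \<in> A" for x
    using partition_onD1[OF part] partition_onD2[OF part] by (auto simp: disjoint_def)
  have c: "c x \<in> \<alpha>" "x \<in> c x" for x
    using theI'[OF ex1[of x]] by (auto simp: c_def)
  have c_eq: "c x = A" if "A \<in> \<alpha>" "x \<in> A" for x A
    using ex1[of x] c[of x] that by blast
  \<comment> \<open>The empty set serves as the blank, being no cell of a partition.\<close>
  define e where "e x = (if x \<in> B (c x) then {} else c x)" for x
  have \<alpha>_ne: "{} \<notin> \<alpha>"
    using partition_onD3[OF part] .

  have c_iff: "c x = A \<longleftrightarrow> x \<in> A" if "A \<in> \<alpha>" for x A
    using c_eq[OF that, of x] c(2)[of x] by auto
  have e_iff: "e x = A \<longleftrightarrow> x \<in> A - B A" if "A \<in> \<alpha>" for x A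
    using c_iff[OF that, of x] B(2)[OF that] that \<alpha>_ne by (auto simp: e_def)
  have e_empty_iff: "e x = {} \<longleftrightarrow> x \<in> B (c x)" for x
    using c(2)[of x] by (auto simp: e_def)
  have c_vimage: "c -` {A} = A" if "A \<in> \<alpha>" for A
    using c_iff[OF that] by auto
  have e_vimage: "e -` {A} = A - B A" if "A \<in> \<alpha>" for A
    using e_iff[OF that] by auto
  have e_vimage_empty: "e -` {{}} = (\<Union>A\<in>\<alpha>. B A)"
  proof (rule set_eqI)
    fix x
    have "x \<in> B (c x) \<longleftrightarrow> (\<exists>A\<in>\<alpha>. x \<in> B A)"
      using c(1)[of x] B(2) c_eq[of _ x] by blast
    then show "x \<in> e -` {{}} \<longleftrightarrow> x \<in> (\<Union>A\<in>\<alpha>. B A)"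
      by (simp add: e_empty_iff)
  qed
  have c_simple: "simple_function \<mu> c"
    unfolding simple_function_def space sets_\<mu>
    using c c_vimage \<alpha>_sets \<open>finite \<alpha>\<close> finite_subset[of "range c" \<alpha>] by auto
  have e_range: "range e \<subseteq> insert {} \<alpha>"
    using c by (auto simp: e_def)
  have B_sets: "B A \<in> sets borel" if "A \<in> \<alpha>" for A
    using B(1) that by simp
  have "e -` {v} \<in> sets borel" if "v \<in> insert {} \<alpha>" for v
    using that B_sets \<alpha>_sets \<open>finite \<alpha>\<close>
    by (auto simp: e_vimage e_vimage_empty intro!: sets.finite_UN)
  then have e_simple: "simple_function \<mu> e"
    unfolding simple_function_def space sets_\<mu>
    using e_range \<open>finite \<alpha>\<close> finite_subset[of "range e" "insert {} \<alpha>"] by auto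

  define X where "X x = (\<lambda>i\<in>{1..n}. c ((T ^^ s i) x))" for x
  define E where "E x = (\<lambda>i\<in>{1..n}. e ((T ^^ s i) x))" for x
  have X_simple: "simple_function \<mu> X" and E_simple: "simple_function \<mu> E"
    unfolding X_def E_def using c_simple e_simple
    by (auto intro!: simple_function_restrict simple_function_comp[OF Tm'])

  have "seq_join T s n \<alpha> - {{}} = (\<lambda>x. X -` {X x} \<inter> space \<mu>) ` space \<mu>"
  proof -
    have cell: "X -` {X x} = (\<Inter>i\<in>{1..n}. (T ^^ s i) -` c ((T ^^ s i) x))" for x
    proof (rule set_eqI)
      fix y
      have "X y = X x \<longleftrightarrow> (\<forall>i\<in>{1..n}. c ((T ^^ s i) y) = c ((T ^^ s i) x))"
        by (auto simp: X_def fun_eq_iff)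
      then show "y \<in> X -` {X x} \<longleftrightarrow> y \<in> (\<Inter>i\<in>{1..n}. (T ^^ s i) -` c ((T ^^ s i) x))"
        by (simp add: c_iff[OF c(1)])
    qed
    have "C \<in> range (\<lambda>x. X -` {X x})" if C: "C \<in> seq_join T s n \<alpha>" and "x \<in> C" for C x
    proof -
      from C obtain a where a: "\<forall>i\<in>{1..n}. a i \<in> \<alpha>" "C = (\<Inter>i\<in>{1..n}. (T ^^ s i) -` a i)"
        unfolding mem_seq_join by blast
      have "c ((T ^^ s i) x) = a i" if "i \<in> {1..n}" for i
        using that \<open>x \<in> C\<close> a by (intro c_eq) auto
      then have "C = X -` {X x}"
        unfolding cell a(2) by (intro INF_cong refl) simp
      then show ?thesis by (rule range_eqI)
    qed
    moreover have "X -` {X x} \<in> seq_join T s n \<alpha>" for x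
      unfolding mem_seq_join cell by (intro exI[of _ "\<lambda>i. c ((T ^^ s i) x)"]) (simp add: c(1))
    moreover have "x \<in> X -` {X x}" for x
      by simp
    ultimately show ?thesis
      unfolding space by (intro set_eqI iffI) auto
  qed
  then have H_X: "shannon_entropy \<mu> (seq_join T s n \<alpha>) = entropy_Pow X"
    by (rule shannon_entropy_eq_entropy[OF refl X_simple])

  let ?\<U> = "fattened_cover \<alpha> B"
  have cover: "finite ?\<U>" "\<And>U. U \<in> ?\<U> \<Longrightarrow> open U" "\<Union>?\<U> = UNIV"
    using finite_open_cover_fattened[OF \<open>finite \<alpha>\<close> part B] by (auto simp: finite_open_cover_def)
  obtain vs where vs: "set vs \<subseteq> seq_join T s n ?\<U>" "\<Union>(set vs) = UNIV"
      "length vs = min_subcover_card (seq_join T s n ?\<U>)"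
    using min_subcover_list[OF finite_seq_join[OF cover(1)] Union_seq_join[OF cover(3)]] .
  have vs_sets: "V \<in> sets \<mu>" if "V \<in> set vs" for V
  proof -
    have "V \<in> seq_join T s n ?\<U>"
      using that vs(1) by (rule subsetD[rotated])
    then obtain a where a: "\<forall>i\<in>{1..n}. a i \<in> ?\<U>" "V = (\<Inter>i\<in>{1..n}. (T ^^ s i) -` a i)"
      unfolding mem_seq_join by (elim exE conjE)
    have "open ((T ^^ s i) -` a i)" if "i \<in> {1..n}" for i
      using a(1) that cover(2) continuous_on_funpow[OF cont] by (simp add: continuous_on_open_vimage)
    then have "open V"
      unfolding a(2) by (intro open_INT) auto
    then show ?thesis
      by (simp add: sets_\<mu>)
  qed
  obtain K where K_simple: "simple_function \<mu> K" and K: "\<And>x. K x < length vs \<and> x \<in> vs ! K x"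
  proof (rule simple_function_first_index[of vs \<mu>])
    show "space \<mu> \<subseteq> \<Union>(set vs)"
      unfolding vs(2) by (rule subset_UNIV)
  qed (simp_all add: vs_sets space)
  \<comment> \<open>All points of \<open>V\<close> that are in some core at time \<open>s i\<close> are in the same core,
    the one named by \<open>a i\<close>.\<close>
  have "\<exists>a. \<forall>i\<in>{1..n}. \<forall>x\<in>V. \<forall>A\<in>\<alpha>. (T ^^ s i) x \<in> B A \<longrightarrow> A = a i" if "V \<in> set vs" for V
  proof -
    have "V \<in> seq_join T s n ?\<U>"
      using that vs(1) by (rule subsetD[rotated])
    then obtain u where u: "\<forall>i\<in>{1..n}. u i \<in> ?\<U>" "V = (\<Inter>i\<in>{1..n}. (T ^^ s i) -` u i)"
      unfolding mem_seq_join by (elim exE conjE)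
    have "\<forall>i\<in>{1..n}. \<exists>A. u i = - (\<Union>A'\<in>\<alpha> - {A}. B A')"
      using u(1) unfolding fattened_cover_def by (intro ballI) (drule (1) bspec, erule imageE, rule exI)
    from bchoice[OF this] obtain a where a: "\<forall>i\<in>{1..n}. u i = - (\<Union>A\<in>\<alpha> - {a i}. B A)" ..
    have "A = a i" if "i \<in> {1..n}" "x \<in> V" "A \<in> \<alpha>" "(T ^^ s i) x \<in> B A" for i x A
    proof -
      have "(T ^^ s i) x \<in> u i"
        using that(1,2) unfolding u(2) by simp
      also have "u i = - (\<Union>A\<in>\<alpha> - {a i}. B A)"
        using a that(1) by (rule bspec)
      finally show ?thesis
        using that(3,4) by blast
    qed
    then show ?thesis
      by (intro exI[of _ a] ballI impI)
  qed
  then have "\<forall>V\<in>set vs. \<exists>a. \<forall>i\<in>{1..n}. \<forall>x\<in>V. \<forall>A\<in>\<alpha>. (T ^^ s i) x \<in> B A \<longrightarrow> A = a i"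
    by (rule ballI)
  from bchoice[OF this] obtain a
    where a: "\<forall>V\<in>set vs. \<forall>i\<in>{1..n}. \<forall>x\<in>V. \<forall>A\<in>\<alpha>. (T ^^ s i) x \<in> B A \<longrightarrow> A = a V i" ..
  \<comment> \<open>\<open>F\<close> recovers the itinerary from the index \<open>K\<close> and the observations \<open>E\<close>,
    filling the blanks with the cells named by \<open>vs ! K x\<close>.\<close>
  define F where "F = (\<lambda>(k, w). \<lambda>i\<in>{1..n}. if w i = {} then a (vs ! k) i else w i)"
  have "X x = F (K x, E x)" for x
  proof -
    have "c ((T ^^ s i) x) = (if E x i = {} then a (vs ! K x) i else E x i)" if i: "i \<in> {1..n}" for i
    proof (cases "(T ^^ s i) x \<in> B (c ((T ^^ s i) x))")
      case True
      then show ?thesis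
        using a[rule_format, OF nth_mem i _ c(1) True] K i by (simp add: E_def e_def)
    next
      case False
      then show ?thesis
        using c(2)[of "(T ^^ s i) x"] i by (auto simp: E_def e_def)
    qed
    then show ?thesis
      unfolding X_def F_def prod.case by (rule restrict_ext)
  qed
  then have X_eq: "X = F \<circ> (\<lambda>x. (K x, E x))"
    by auto
  have "entropy_Pow X \<le> entropy_Pow (\<lambda>x. (K x, E x))"
    unfolding X_eq
    by (rule entropy_data_processing[OF simple_function_Pair[OF K_simple E_simple]])
  also have "\<dots> \<le> entropy_Pow K + entropy_Pow E"
    using K_simple E_simple by (rule entropy_Pair_le)
  finally have "entropy_Pow X \<le> entropy_Pow K + entropy_Pow E" .
  moreover have "entropy_Pow K \<le> ln (real (length vs))"
  proof -
    have "entropy_Pow K \<le> log (exp 1) (real (card (K ` space \<mu>)))"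
      by (rule entropy_le_card[OF simple_distributedI[OF K_simple measure_nonneg refl]])
    also have "\<dots> = ln (real (card (range K)))"
      by (simp add: space log_def)
    also have "\<dots> \<le> ln (real (length vs))"
    proof (rule ln_mono)
      have "card (range K) \<le> card {..<length vs}"
        using K by (intro card_mono) auto
      then show "real (card (range K)) \<le> real (length vs)"
        by simp
      have "finite (range K)"
        using simple_functionD(1)[OF K_simple] by (simp add: space)
      then show "0 < real (card (range K))"
        by (simp add: card_gt_0_iff)
    qed
    finally show ?thesis .
  qed
  moreover have "entropy_Pow E \<le> real n * (2 * real (card \<alpha>) * r)"
  proof -
    have e_shift: "simple_function \<mu> (\<lambda>x. e ((T ^^ s i) x))" for i
      by (rule simple_function_comp[OF Tm' e_simple])
    have "entropy_Pow (\<lambda>x. e ((T ^^ s i) x)) \<le> 2 * real (card \<alpha>) * r" for i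
    proof (rule entropy_le_almost_constant[OF refl e_shift _ \<open>finite \<alpha>\<close> \<alpha>_ne _ \<open>0 \<le> r\<close>])
      show "(\<lambda>x. e ((T ^^ s i) x)) ` space \<mu> \<subseteq> insert {} \<alpha>"
        by (intro image_subsetI subsetD[OF e_range] rangeI)
      fix A assume A: "A \<in> \<alpha>"
      have "(\<lambda>x. e ((T ^^ s i) x)) -` {A} \<inter> space \<mu> = (T ^^ s i) -` (A - B A)"
        unfolding e_vimage[OF A, symmetric] space by auto
      moreover have "A - B A \<in> sets borel"
        using \<alpha>_sets[OF A] B_sets[OF A] by (rule sets.Diff)
      ultimately show "prob ((\<lambda>x. e ((T ^^ s i) x)) -` {A} \<inter> space \<mu>) \<le> r\<^sup>2"
        using small[OF A] by (simp only: invariant_prob_funpow[OF cont inv])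
    qed
    then have "(\<Sum>i\<in>{1..n}. entropy_Pow (\<lambda>x. e ((T ^^ s i) x))) \<le> (\<Sum>i\<in>{1..n}. 2 * real (card \<alpha>) * r)"
      by (rule sum_mono)
    moreover have "entropy_Pow E \<le> (\<Sum>i\<in>{1..n}. entropy_Pow (\<lambda>x. e ((T ^^ s i) x)))"
      unfolding E_def[abs_def] using e_shift by (intro entropy_restrict_le) simp
    ultimately show ?thesis
      by simp
  qed
  ultimately show ?thesis
    unfolding H_X vs(3)[symmetric] by linarith
qed

text \<open>
  If the entropy of the joins of \<open>\<alpha>\<close> exceeds \<open>h n\<close> eventually, cores that cost at most \<open>h / 2\<close> per
  observation leave \<open>h n / 2\<close> for the logarithm of the size of minimal subcovers.
\<close>

lemma measure_entropy_generating_imp_cover: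
  fixes T :: "'a::topological_space \<Rightarrow> 'a"
  assumes tds: "tds T" and inv: "invariant_prob T \<mu>"
    and \<alpha>: "finite_borel_partition \<alpha>" and s: "measure_entropy_generating \<mu> T \<alpha> s"
  obtains \<U> where "finite_open_cover \<U>" "cover_entropy_generating T \<U> s"
proof -
  have cont: "continuous_on UNIV T" and metr: "metrizable_space (euclidean :: 'a topology)"
    using tds by (auto simp: tds_def)
  have "prob_space \<mu>" and sets_\<mu>: "sets \<mu> = sets borel"
    using inv by (auto simp: invariant_prob_def)
  interpret prob_space \<mu> by fact
  have "finite \<alpha>" and \<alpha>_sets: "\<And>A. A \<in> \<alpha> \<Longrightarrow> A \<in> sets borel" and part: "partition_on UNIV \<alpha>"
    using \<alpha> by (auto simp: finite_borel_partition_def)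
  from s have "0 < liminf (\<lambda>n. ereal (1 / real n * shannon_entropy \<mu> (seq_join T s n \<alpha>)))"
    by (simp add: measure_entropy_generating_def)
  then obtain h where "0 < h"
      and h: "ereal h < liminf (\<lambda>n. ereal (1 / real n * shannon_entropy \<mu> (seq_join T s n \<alpha>)))"
    using ereal_dense2[of 0] by (metis ereal_less(2))
  \<comment> \<open>Chosen to make the cost per observation at most \<open>h / 2\<close>.
    The summand 1 keeps the denominator positive whatever the size of \<open>\<alpha>\<close>.\<close>
  define r where "r = h / (4 * (real (card \<alpha>) + 1))"
  have "r > 0"
    using \<open>0 < h\<close> by (simp add: r_def)
  have r: "2 * real (card \<alpha>) * r \<le> h / 2"
    using \<open>0 < h\<close> by (simp add: r_def field_simps)
  have "\<exists>C. closed C \<and> C \<subseteq> A \<and> measure \<mu> (A - C) \<le> r\<^sup>2" if A: "A \<in> \<alpha>" for A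
  proof -
    obtain C U where CU: "closed C" "open U" "C \<subseteq> A" "A \<subseteq> U" "measure \<mu> (U - C) < r\<^sup>2"
      using closed_open_sandwich[OF finite_measure_axioms sets_\<mu> metr \<alpha>_sets[OF A], of "r\<^sup>2"] \<open>r > 0\<close>
      by auto
    then have "measure \<mu> (A - C) \<le> measure \<mu> (U - C)"
      by (intro finite_measure_mono) (auto simp: sets_\<mu>)
    with CU show ?thesis by force
  qed
  then obtain B where B: "\<And>A. A \<in> \<alpha> \<Longrightarrow> closed (B A)" "\<And>A. A \<in> \<alpha> \<Longrightarrow> B A \<subseteq> A"
      "\<And>A. A \<in> \<alpha> \<Longrightarrow> measure \<mu> (A - B A) \<le> r\<^sup>2"
    by metis
  let ?\<U> = "fattened_cover \<alpha> B"
  let ?N = "\<lambda>n. real (min_subcover_card (seq_join T s n ?\<U>))"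
  have "\<forall>\<^sub>F n in sequentially. ereal (h / 2) \<le> ereal (1 / real n * ln (?N n))"
    using less_LiminfD[OF h] eventually_gt_at_top[of 0]
  proof eventually_elim
    case (elim n)
    have "shannon_entropy \<mu> (seq_join T s n \<alpha>) \<le> ln (?N n) + real n * (2 * real (card \<alpha>) * r)"
      using cont inv \<alpha> B \<open>r > 0\<close> by (intro shannon_entropy_seq_join_le) auto
    also have "\<dots> \<le> ln (?N n) + real n * (h / 2)"
      using r by (intro add_left_mono mult_left_mono) auto
    finally show ?case
      using elim by (simp add: field_simps)
  qed
  then have "ereal (h / 2) \<le> liminf (\<lambda>n. ereal (1 / real n * ln (?N n)))"
    by (rule Liminf_bounded)
  then have "0 < liminf (\<lambda>n. ereal (1 / real n * ln (?N n)))"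
    using \<open>0 < h\<close> by (simp add: order_less_le_trans[of 0 "ereal (h / 2)"])
  moreover have "increasing_seq s"
    using s unfolding measure_entropy_generating_def by (rule conjunct1)
  ultimately have "cover_entropy_generating T ?\<U> s"
    unfolding cover_entropy_generating_def by (intro conjI)
  with finite_open_cover_fattened[OF \<open>finite \<alpha>\<close> part B(1,2)] show ?thesis
    by (rule that)
qed

theorem theorem4p5:
  fixes T :: "'a::topological_space \<Rightarrow> 'a" and \<mu> :: "'a measure"
  assumes "tds T" and "invariant_prob T \<mu>"
  shows "measure_upper_entropy_dim \<mu> T \<le> top_upper_entropy_dim T"
  unfolding measure_upper_entropy_dim_def partition_upper_dim_def
proof (intro SUP_least)
  fix \<alpha> s
  assume "\<alpha> \<in> {\<alpha>. finite_borel_partition \<alpha>}" "s \<in> {s. measure_entropy_generating \<mu> T \<alpha> s}"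
  then obtain \<U> where "finite_open_cover \<U>" "cover_entropy_generating T \<U> s"
    using measure_entropy_generating_imp_cover[OF assms] by blast
  then have "upper_dim s \<le> cover_upper_dim T \<U>" "cover_upper_dim T \<U> \<le> top_upper_entropy_dim T"
    unfolding top_upper_entropy_dim_def cover_upper_dim_def by (auto intro: SUP_upper)
  then show "upper_dim s \<le> top_upper_entropy_dim T"
    by (rule order_trans)
qed

end
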